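(* Let $S$ be a proper restriction semigroup. Put $T=S/\sigma$ and $Y=P_S$. Then $S\cong W(T,Y)$, where the sub-action of $T$ on $Y$, by isomorphisms between ideals, is induced by the subhomomorphism $\kappa\overline{\theta}:T\to TI_Y$, the composition of the injection $\kappa$ of $T$ in $C(S)$ with the extension $\overline\theta$ of the Munn representation $\theta$ of $S$ to $C(S)$. If $S$ is an $F$-restriction monoid, then $Y=Y^1$ (that is, $Y$ has an identity) and the sub-action of $T$ on $Y$ is by isomorphisms between principal ideals, induced by the Munn representation of $S$ itself (that is, given by $a\sigma\mapsto\theta_{m_a}$, where $m_a$ is the greatest element of $a\sigma$).
   Context: A restriction semigroup is an algebra $(S,\cdot,{}^+,{}^* )$ with $(S,\cdot)$ a semigroup, satisfying $x^+x=x$, $(x^+y)^+=x^+y^+$, $x^+y^+=y^+x^+$, $xy^+=(xy)^+x$, the dual identities $xx^*=x$, $(yx^* )^*=y^*x^*$, $y^*x^*=x^*y^*$, $y^*x=x(yx)^*$, and $(x^+)^*=x^+$, $(x^* )^+=x^*$. Its projections form the semilattice $P_S=\{x^+:x\in S\}=\{x^*:x\in S\}$. A restriction monoid is a restriction semigroup with identity $1$ (so $1^+=1^*=1$). The natural partial order is $a\le b$ iff $a=eb$ for some $e\in P_S$; order ideals are nonempty downward-closed subsets. Relations on $S$: $a\mathrel{\mathbb R}b$ iff $a^+=b^+$; $a\mathrel{\mathbb L}b$ iff $a^*=b^*$; $\sigma=\{(a,b): ea=eb\text{ for some }e\in P_S\}$ is the least congruence identifying all projections. $S$ is proper if $\mathbb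 R\cap\sigma$ and $\mathbb L\cap\sigma$ are both the identity relation. A restriction monoid is $F$-restriction if it is proper and every $\sigma$-class has a greatest element. For a semilattice $Y$, ideals are nonempty downward-closed subsets. $TI_Y$ is the inverse monoid of all isomorphisms between ideals of $Y$, under composition of partial maps (written on the right, composed left to right); $T_Y$ is its inverse subsemigroup of isomorphisms between principal ideals. A sub-action of a monoid $T$ on $Y$ is a map $\alpha:T\to TI_Y$ with $1\alpha=1$ and $(t\alpha)(u\alpha)\le(tu)\alpha$ (restriction of partial maps). Writing $\Delta t,\nabla t$ for the domain and range of $t\alpha$, and $e^t=e(t\alpha)$ for $e\in\Delta t$, $$W(T,Y)=\{(t,e^t)\in T\times Y: e\in\Delta t\}=\{(t,f)\in T\times Y: f\in\nabla t\},$$ with $(t,e^t)(u,f^u)=(tu,(e^tf)^u)$, $(t,e^t)^+=(1,e)$, $(t,f)^*=(1,f)$. The Munn representation of $S$ is $\theta:S\to T_{P_S}$, $a\mapsto\theta_a$, where $\theta_a$ has domain $\{e\in P_S:e\le a^+\}$ and $e\theta_a=(ea)^*$. A permissible subset of $S$ is an order ideal $A$ with $a^+b=b^+a$ and $ab^*=ba^*$ for all $a,b\in A$; the set $C(S)$ of permissible subsets is a restriction monoid under multiplication of subsets, with $A^+=\{a^+:a\in A\}$, $A^*=\{a^*:a\in A\}$ and identity $P_S$. The extension $\overline\theta:C(S)\to TI_{P_S}$ of $\theta$ sends $A$ to $\overline\theta_A=\bigcup_{a\in A}\theta_a$, which is an isomorphism from the ideal $A^+$ onto the ideal $A^*$.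 When $S$ is proper, each $\sigma$-class is permissible and $\kappa:S/\sigma\to C(S)$ is the inclusion of the set of $\sigma$-classes. *)

theory Defs
  imports "HOL-Algebra.Group"
begin

record 'a sgroup = "'a partial_object" +
  sg_mult :: "['a, 'a] \<Rightarrow> 'a" (infixl "\<cdot>\<index>" 70)

locale semilattice_sg =
  fixes Y (structure)
  assumes nonempty: "carrier Y \<noteq> {}"
    and closed: "\<lbrakk>e \<in> carrier Y; f \<in> carrier Y\<rbrakk> \<Longrightarrow> e \<cdot> f \<in> carrier Y"
    and assoc: "\<lbrakk>e \<in> carrier Y; f \<in> carrier Y; g \<in> carrier Y\<rbrakk> \<Longrightarrow> (e \<cdot> f) \<cdot> g = e \<cdot> (f \<cdot> g)"
    and comm: "\<lbrakk>e \<in> carrier Y; f \<in> carrier Y\<rbrakk> \<Longrightarrow> e \<cdot> f = f \<cdot> e"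
    and idem: "e \<in> carrier Y \<Longrightarrow> e \<cdot> e = e"

definition has_identity :: "('a, 'm) sgroup_scheme \<Rightarrow> bool" where
  "has_identity S \<longleftrightarrow> (\<exists>u\<in>carrier S. \<forall>x\<in>carrier S. u \<cdot>\<^bsub>S\<^esub> x = x \<and> x \<cdot>\<^bsub>S\<^esub> u = x)"

definition sl_le :: "('a, 'm) sgroup_scheme \<Rightarrow> 'a \<Rightarrow> 'a \<Rightarrow> bool" where
  "sl_le Y e f \<longleftrightarrow> e = e \<cdot>\<^bsub>Y\<^esub> f"

definition sl_ideal :: "('a, 'm) sgroup_scheme \<Rightarrow> 'a set \<Rightarrow> bool" where
  "sl_ideal Y I \<longleftrightarrow> I \<subseteq> carrier Y \<and> I \<noteq> {} \<and>
     (\<forall>f\<in>I. \<forall>e\<in>carrier Y. sl_le Y e f \<longrightarrow> e \<in> I)"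

definition principal_ideal :: "('a, 'm) sgroup_scheme \<Rightarrow> 'a \<Rightarrow> 'a set" where
  "principal_ideal Y f = {e \<in> carrier Y. sl_le Y e f}"

text \<open>
  Partial maps are represented by their graphs. As they are written on the right and
  composed from left to right, their composition is relational composition \<open>r O s\<close>, the
  order by restriction is inclusion of graphs, and the inverse is the converse relation.
\<close>

definition ideal_iso ::
  "('a, 'm) sgroup_scheme \<Rightarrow> 'a set \<Rightarrow> 'a set \<Rightarrow> ('a \<times> 'a) set \<Rightarrow> bool" where
  "ideal_iso Y I J r \<longleftrightarrow> Domain r = I \<and> Range r = J \<and>
     single_valued r \<and> single_valued (r\<inverse>) \<and>
     (\<forall>(e, e')\<in>r. \<forall>(f, f')\<in>r. (e \<cdot>\<^bsub>Y\<^esub> f, e' \<cdot>\<^bsub>Y\<^esub> f') \<in> r)"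

definition TI :: "('a, 'm) sgroup_scheme \<Rightarrow> ('a \<times> 'a) set set" where
  "TI Y = {r. \<exists>I J. sl_ideal Y I \<and> sl_ideal Y J \<and> ideal_iso Y I J r}"

definition TP :: "('a, 'm) sgroup_scheme \<Rightarrow> ('a \<times> 'a) set set" where
  "TP Y = {r. \<exists>e\<in>carrier Y. \<exists>f\<in>carrier Y.
                 ideal_iso Y (principal_ideal Y e) (principal_ideal Y f) r}"

definition app :: "('a \<times> 'a) set \<Rightarrow> 'a \<Rightarrow> 'a" where
  "app r e = (THE f. (e, f) \<in> r)"

text \<open>
  The unary operations \<open>\<^sup>+\<close> and \<open>\<^sup>*\<close> are written \<open>\<^sup>\<oplus>\<close> and \<open>\<^sup>\<star>\<close>, since the former denote
  transitive closures in HOL.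
\<close>

record 'a restr = "'a sgroup" +
  rplus :: "'a \<Rightarrow> 'a" ("_\<^sup>\<oplus>\<index>" [1000] 999)
  rstar :: "'a \<Rightarrow> 'a" ("_\<^sup>\<star>\<index>" [1000] 999)

locale restriction_semigroup =
  fixes S (structure)
  assumes nonempty: "carrier S \<noteq> {}"
    and mult_closed: "\<lbrakk>x \<in> carrier S; y \<in> carrier S\<rbrakk> \<Longrightarrow> x \<cdot> y \<in> carrier S"
    and plus_closed: "x \<in> carrier S \<Longrightarrow> x\<^sup>\<oplus> \<in> carrier S"
    and star_closed: "x \<in> carrier S \<Longrightarrow> x\<^sup>\<star> \<in> carrier S"
    and assoc: "\<lbrakk>x \<in> carrier S; y \<in> carrier S; z \<in> carrier S\<rbrakk> \<Longrightarrow> (x \<cdot> y) \<cdot> z = x \<cdot> (y \<cdot> z)"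
    and plus_left: "x \<in> carrier S \<Longrightarrow> x\<^sup>\<oplus> \<cdot> x = x"
    and plus_mult: "\<lbrakk>x \<in> carrier S; y \<in> carrier S\<rbrakk> \<Longrightarrow> (x\<^sup>\<oplus> \<cdot> y)\<^sup>\<oplus> = x\<^sup>\<oplus> \<cdot> y\<^sup>\<oplus>"
    and plus_comm: "\<lbrakk>x \<in> carrier S; y \<in> carrier S\<rbrakk> \<Longrightarrow> x\<^sup>\<oplus> \<cdot> y\<^sup>\<oplus> = y\<^sup>\<oplus> \<cdot> x\<^sup>\<oplus>"
    and plus_ample: "\<lbrakk>x \<in> carrier S; y \<in> carrier S\<rbrakk> \<Longrightarrow> x \<cdot> y\<^sup>\<oplus> = (x \<cdot> y)\<^sup>\<oplus> \<cdot> x"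
    and star_right: "x \<in> carrier S \<Longrightarrow> x \<cdot> x\<^sup>\<star> = x"
    and star_mult: "\<lbrakk>x \<in> carrier S; y \<in> carrier S\<rbrakk> \<Longrightarrow> (y \<cdot> x\<^sup>\<star>)\<^sup>\<star> = y\<^sup>\<star> \<cdot> x\<^sup>\<star>"
    and star_comm: "\<lbrakk>x \<in> carrier S; y \<in> carrier S\<rbrakk> \<Longrightarrow> y\<^sup>\<star> \<cdot> x\<^sup>\<star> = x\<^sup>\<star> \<cdot> y\<^sup>\<star>"
    and star_ample: "\<lbrakk>x \<in> carrier S; y \<in> carrier S\<rbrakk> \<Longrightarrow> y\<^sup>\<star> \<cdot> x = x \<cdot> (y \<cdot> x)\<^sup>\<star>"
    and plus_star: "x \<in> carrier S \<Longrightarrow> (x\<^sup>\<oplus>)\<^sup>\<star> = x\<^sup>\<oplus>"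
    and star_plus: "x \<in> carrier S \<Longrightarrow> (x\<^sup>\<star>)\<^sup>\<oplus> = x\<^sup>\<star>"

definition restr_iso ::
  "('a, 'm) restr_scheme \<Rightarrow> ('b, 'n) restr_scheme \<Rightarrow> ('a \<Rightarrow> 'b) set" where
  "restr_iso S S' = {\<phi>. bij_betw \<phi> (carrier S) (carrier S') \<and>
     (\<forall>x\<in>carrier S. \<forall>y\<in>carrier S. \<phi> (x \<cdot>\<^bsub>S\<^esub> y) = \<phi> x \<cdot>\<^bsub>S'\<^esub> \<phi> y) \<and>
     (\<forall>x\<in>carrier S. \<phi> (x\<^sup>\<oplus>\<^bsub>S\<^esub>) = (\<phi> x)\<^sup>\<oplus>\<^bsub>S'\<^esub>) \<and>
     (\<forall>x\<in>carrier S. \<phi> (x\<^sup>\<star>\<^bsub>S\<^esub>) = (\<phi> x)\<^sup>\<star>\<^bsub>S'\<^esub>)}"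

definition proj :: "('a, 'm) restr_scheme \<Rightarrow> 'a set" where
  "proj S = rplus S ` carrier S"

definition proj_sl :: "('a, 'm) restr_scheme \<Rightarrow> 'a sgroup" where
  "proj_sl S = \<lparr>carrier = proj S, sg_mult = sg_mult S\<rparr>"

definition nat_le :: "('a, 'm) restr_scheme \<Rightarrow> 'a \<Rightarrow> 'a \<Rightarrow> bool" where
  "nat_le S a b \<longleftrightarrow> (\<exists>e\<in>proj S. a = e \<cdot>\<^bsub>S\<^esub> b)"

definition order_ideal :: "('a, 'm) restr_scheme \<Rightarrow> 'a set \<Rightarrow> bool" where
  "order_ideal S A \<longleftrightarrow> A \<subseteq> carrier S \<and> A \<noteq> {} \<and>
     (\<forall>b\<in>A. \<forall>a\<in>carrier S. nat_le S a b \<longrightarrow> a \<in> A)"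

definition R_rel :: "('a, 'm) restr_scheme \<Rightarrow> ('a \<times> 'a) set" where
  "R_rel S = {(a, b) \<in> carrier S \<times> carrier S. a\<^sup>\<oplus>\<^bsub>S\<^esub> = b\<^sup>\<oplus>\<^bsub>S\<^esub>}"

definition L_rel :: "('a, 'm) restr_scheme \<Rightarrow> ('a \<times> 'a) set" where
  "L_rel S = {(a, b) \<in> carrier S \<times> carrier S. a\<^sup>\<star>\<^bsub>S\<^esub> = b\<^sup>\<star>\<^bsub>S\<^esub>}"

definition sigma :: "('a, 'm) restr_scheme \<Rightarrow> ('a \<times> 'a) set" where
  "sigma S = {(a, b) \<in> carrier S \<times> carrier S. \<exists>e\<in>proj S. e \<cdot>\<^bsub>S\<^esub> a = e \<cdot>\<^bsub>S\<^esub> b}"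

locale proper_restriction_semigroup = restriction_semigroup +
  assumes R_proper: "R_rel S \<inter> sigma S = Id_on (carrier S)"
    and L_proper: "L_rel S \<inter> sigma S = Id_on (carrier S)"

definition is_greatest :: "('a, 'm) restr_scheme \<Rightarrow> 'a set \<Rightarrow> 'a \<Rightarrow> bool" where
  "is_greatest S A m \<longleftrightarrow> m \<in> A \<and> (\<forall>a\<in>A. nat_le S a m)"

definition max_elem :: "('a, 'm) restr_scheme \<Rightarrow> 'a set \<Rightarrow> 'a" where
  "max_elem S A = (THE m. is_greatest S A m)"

locale F_restriction_monoid = proper_restriction_semigroup +
  assumes identity: "has_identity S"
    and class_greatest: "A \<in> carrier S // sigma S \<Longrightarrow> \<exists>m. is_greatest S A m"

text \<open>The identity of \<open>S/\<sigma>\<close> is the \<open>\<sigma>\<close>-class of the projections.\<close>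

definition sigma_quot :: "('a, 'm) restr_scheme \<Rightarrow> 'a set monoid" where
  "sigma_quot S = \<lparr>carrier = carrier S // sigma S,
     mult = (\<lambda>A B. \<Union>a\<in>A. \<Union>b\<in>B. sigma S `` {a \<cdot>\<^bsub>S\<^esub> b}),
     one = sigma S `` proj S\<rparr>"

locale sub_action = monoid T + semilattice_sg Y
  for T (structure) and Y :: "('b, 'n) sgroup_scheme" +
  fixes \<alpha> :: "'a \<Rightarrow> ('b \<times> 'b) set"
  assumes in_TI: "t \<in> carrier T \<Longrightarrow> \<alpha> t \<in> TI Y"
    and one: "\<alpha> \<one> = Id_on (carrier Y)"
    and sub_mult: "\<lbrakk>t \<in> carrier T; u \<in> carrier T\<rbrakk> \<Longrightarrow> \<alpha> t O \<alpha> u \<subseteq> \<alpha> (t \<otimes> u)"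

text \<open>
  An element \<open>(t, g)\<close> of \<open>W(T,Y)\<close> has \<open>g = e\<^sup>t\<close> for a unique \<open>e\<close> in the domain of \<open>\<alpha> t\<close>,
  namely \<open>e = app ((\<alpha> t)\<inverse>) g\<close>; this turns \<open>(t, e\<^sup>t)(u, f\<^sup>u) = (tu, (e\<^sup>tf)\<^sup>u)\<close> and
  \<open>(t, e\<^sup>t)\<^sup>+ = (1, e)\<close> into the formulas below.
\<close>

definition W :: "('t, 'm) monoid_scheme \<Rightarrow> ('b, 'n) sgroup_scheme \<Rightarrow>
    ('t \<Rightarrow> ('b \<times> 'b) set) \<Rightarrow> ('t \<times> 'b) restr" where
  "W T Y \<alpha> = \<lparr>carrier = {(t, g). t \<in> carrier T \<and> g \<in> Range (\<alpha> t)},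
     sg_mult = (\<lambda>(t, g) (u, h). (t \<otimes>\<^bsub>T\<^esub> u, app (\<alpha> u) (g \<cdot>\<^bsub>Y\<^esub> app ((\<alpha> u)\<inverse>) h))),
     rplus = (\<lambda>(t, g). (\<one>\<^bsub>T\<^esub>, app ((\<alpha> t)\<inverse>) g)),
     rstar = (\<lambda>(t, g). (\<one>\<^bsub>T\<^esub>, g))\<rparr>"

definition permissible :: "('a, 'm) restr_scheme \<Rightarrow> 'a set \<Rightarrow> bool" where
  "permissible S A \<longleftrightarrow> order_ideal S A \<and>
     (\<forall>a\<in>A. \<forall>b\<in>A. a\<^sup>\<oplus>\<^bsub>S\<^esub> \<cdot>\<^bsub>S\<^esub> b = b\<^sup>\<oplus>\<^bsub>S\<^esub> \<cdot>\<^bsub>S\<^esub> a \<and> a \<cdot>\<^bsub>S\<^esub> b\<^sup>\<star>\<^bsub>S\<^esub> = b \<cdot>\<^bsub>S\<^esub> a\<^sup>\<star>\<^bsub>S\<^esub>)"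

definition perm_monoid :: "('a, 'm) restr_scheme \<Rightarrow> 'a set restr" where
  "perm_monoid S = \<lparr>carrier = {A. permissible S A},
     sg_mult = (\<lambda>A B. {a \<cdot>\<^bsub>S\<^esub> b |a b. a \<in> A \<and> b \<in> B}),
     rplus = (\<lambda>A. rplus S ` A),
     rstar = (\<lambda>A. rstar S ` A)\<rparr>"

definition munn :: "('a, 'm) restr_scheme \<Rightarrow> 'a \<Rightarrow> ('a \<times> 'a) set" where
  "munn S a = {(e, (e \<cdot>\<^bsub>S\<^esub> a)\<^sup>\<star>\<^bsub>S\<^esub>) |e. e \<in> proj S \<and> nat_le S e (a\<^sup>\<oplus>\<^bsub>S\<^esub>)}"

definition munn_ext :: "('a, 'm) restr_scheme \<Rightarrow> 'a set \<Rightarrow> ('a \<times> 'a) set" where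
  "munn_ext S A = (\<Union>a\<in>A. munn S a)"

definition kappa :: "('a, 'm) restr_scheme \<Rightarrow> 'a set \<Rightarrow> 'a set" where
  "kappa S = (\<lambda>A\<in>carrier (sigma_quot S). A)"

end

theory Submission
  imports Defs
begin

text \<open>
  For a permissible set \<open>A\<close> the partial map \<open>munn_ext S A\<close> is simply
  \<open>{(a\<^sup>\<oplus>, a\<^sup>\<star>) | a. a \<in> A}\<close>, because a pair \<open>(e, (ea)\<^sup>\<star>)\<close> with \<open>e \<le> a\<^sup>\<oplus>\<close> comes from \<open>ea \<in> A\<close>.
  In a proper restriction semigroup an element is determined by its \<open>\<sigma>\<close>-class \<open>t\<close> together
  with \<open>a\<^sup>\<star>\<close>, which lies in the range of the map attached to \<open>t\<close>; hence \<open>a \<mapsto> (a\<sigma>, a\<^sup>\<star>)\<close> is the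
  isomorphism onto \<open>W(T,Y)\<close>. If \<open>t\<close> has a greatest element \<open>m\<close>, then \<open>t\<close> is the set of elements
  below \<open>m\<close>, and the map attached to \<open>t\<close> is the Munn map of \<open>m\<close>.
\<close>

section \<open>Projections and identities for the two unary operations\<close>

context restriction_semigroup
begin

lemma plus_in_proj [simp]: "x \<in> carrier S \<Longrightarrow> x\<^sup>\<oplus> \<in> proj S"
  by (simp add: proj_def)

lemma star_in_proj [simp]: "x \<in> carrier S \<Longrightarrow> x\<^sup>\<star> \<in> proj S"
  by (metis plus_in_proj star_closed star_plus)

lemma proj_closed [simp]: "e \<in> proj S \<Longrightarrow> e \<in> carrier S"
  by (auto simp: proj_def plus_closed)

lemma proj_star [simp]: "e \<in> proj S \<Longrightarrow> e\<^sup>\<star> = e"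
  by (auto simp: proj_def plus_star)

lemma proj_plus [simp]: "e \<in> proj S \<Longrightarrow> e\<^sup>\<oplus> = e"
  by (metis proj_closed proj_star star_plus)

lemma proj_idem [simp]: "e \<in> proj S \<Longrightarrow> e \<cdot> e = e"
  by (metis proj_closed proj_plus plus_left)

lemma proj_mult [simp]: "e \<in> proj S \<Longrightarrow> f \<in> proj S \<Longrightarrow> e \<cdot> f \<in> proj S"
  by (metis plus_in_proj mult_closed plus_mult proj_closed proj_plus)

lemma proj_comm: "e \<in> proj S \<Longrightarrow> f \<in> proj S \<Longrightarrow> e \<cdot> f = f \<cdot> e"
  by (metis plus_comm proj_closed proj_plus)

lemma plus_proj_mult: "e \<in> proj S \<Longrightarrow> x \<in> carrier S \<Longrightarrow> (e \<cdot> x)\<^sup>\<oplus> = e \<cdot> x\<^sup>\<oplus>"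
  by (metis plus_mult proj_closed proj_plus)

lemma star_mult_proj: "e \<in> proj S \<Longrightarrow> x \<in> carrier S \<Longrightarrow> (x \<cdot> e)\<^sup>\<star> = x\<^sup>\<star> \<cdot> e"
  by (metis star_mult proj_closed proj_star)

lemma mult_proj: "e \<in> proj S \<Longrightarrow> x \<in> carrier S \<Longrightarrow> x \<cdot> e = (x \<cdot> e)\<^sup>\<oplus> \<cdot> x"
  by (metis plus_ample proj_closed proj_plus)

lemma proj_mult_left: "e \<in> proj S \<Longrightarrow> x \<in> carrier S \<Longrightarrow> e \<cdot> x = x \<cdot> (e \<cdot> x)\<^sup>\<star>"
  by (metis star_ample proj_closed proj_star)

text \<open>The ample identity turns \<open>x \<cdot> y\<^sup>\<oplus>\<close> into
  \<open>(x \<cdot> y)\<^sup>\<oplus> \<cdot> x\<close>, and the remaining factor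
  \<open>x\<^sup>\<oplus>\<close> is absorbed because it fixes \<open>x \<cdot> y\<close> on the
  left. Together with its dual below, this computes both projections of a product once
  \<open>x\<^sup>\<star> = y\<^sup>\<oplus>\<close>.\<close>

lemma plus_mult_plus:
  assumes "x \<in> carrier S" "y \<in> carrier S"
  shows "(x \<cdot> y\<^sup>\<oplus>)\<^sup>\<oplus> = (x \<cdot> y)\<^sup>\<oplus>"
proof -
  have "(x \<cdot> y\<^sup>\<oplus>)\<^sup>\<oplus> = (x \<cdot> y)\<^sup>\<oplus> \<cdot> x\<^sup>\<oplus>"
    using assms by (metis mult_closed plus_ample plus_mult)
  also have "\<dots> = (x\<^sup>\<oplus> \<cdot> (x \<cdot> y))\<^sup>\<oplus>"
    using assms by (metis mult_closed plus_comm plus_mult)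
  also have "x\<^sup>\<oplus> \<cdot> (x \<cdot> y) = x \<cdot> y"
    using assms by (metis assoc plus_closed plus_left)
  finally show ?thesis .
qed

lemma star_star_mult:
  assumes "x \<in> carrier S" "y \<in> carrier S"
  shows "(x\<^sup>\<star> \<cdot> y)\<^sup>\<star> = (x \<cdot> y)\<^sup>\<star>"
proof -
  have "(x\<^sup>\<star> \<cdot> y)\<^sup>\<star> = y\<^sup>\<star> \<cdot> (x \<cdot> y)\<^sup>\<star>"
    using assms by (metis mult_closed star_ample star_mult)
  also have "\<dots> = ((x \<cdot> y) \<cdot> y\<^sup>\<star>)\<^sup>\<star>"
    using assms by (metis star_mult mult_closed star_comm)
  also have "(x \<cdot> y) \<cdot> y\<^sup>\<star> = x \<cdot> y"
    using assms by (simp add: assoc star_closed star_right)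
  finally show ?thesis .
qed

section \<open>The natural partial order\<close>

lemma nat_leI: "e \<in> proj S \<Longrightarrow> nat_le S (e \<cdot> b) b"
  by (auto simp: nat_le_def)

lemma nat_le_mult_proj: "e \<in> proj S \<Longrightarrow> b \<in> carrier S \<Longrightarrow> nat_le S (b \<cdot> e) b"
  by (metis mult_closed mult_proj nat_leI plus_in_proj proj_closed)

lemma nat_le_refl: "a \<in> carrier S \<Longrightarrow> nat_le S a a"
  by (metis nat_leI plus_in_proj plus_left)

lemma nat_le_trans:
  assumes "nat_le S a b" "nat_le S b c" "c \<in> carrier S"
  shows "nat_le S a c"
proof -
  obtain e f where "e \<in> proj S" "f \<in> proj S" "a = e \<cdot> (f \<cdot> c)"
    using assms by (auto simp: nat_le_def)
  then have "a = (e \<cdot> f) \<cdot> c" "e \<cdot> f \<in> proj S"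
    using assms(3) by (simp_all add: assoc)
  then show ?thesis
    by (auto simp: nat_le_def)
qed

text \<open>The existential multiplier in \<open>nat_le\<close> can be replaced by a canonical one:
  if \<open>a = e \<cdot> b\<close> then
  \<open>a\<^sup>\<oplus> = e \<cdot> b\<^sup>\<oplus>\<close>, and \<open>b\<^sup>\<oplus>\<close>
  fixes \<open>b\<close>.\<close>

lemma nat_le_plus:
  assumes "nat_le S a b" "b \<in> carrier S"
  shows "a = a\<^sup>\<oplus> \<cdot> b"
proof -
  obtain e where e: "e \<in> proj S" "a = e \<cdot> b"
    using assms(1) by (auto simp: nat_le_def)
  have "a\<^sup>\<oplus> \<cdot> b = e \<cdot> b\<^sup>\<oplus> \<cdot> b"
    using e assms(2) by (simp add: plus_proj_mult)
  also have "\<dots> = a"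
    using e assms(2) by (simp add: assoc plus_closed plus_left)
  finally show ?thesis by simp
qed

lemma nat_le_star: "nat_le S a b \<Longrightarrow> b \<in> carrier S \<Longrightarrow> a = b \<cdot> a\<^sup>\<star>"
  by (metis nat_le_def proj_mult_left)

lemma nat_le_antisym:
  assumes "nat_le S a b" "nat_le S b a" "a \<in> carrier S" "b \<in> carrier S"
  shows "a = b"
proof -
  have "a = a\<^sup>\<oplus> \<cdot> (b\<^sup>\<oplus> \<cdot> a)"
    using assms by (metis nat_le_plus)
  also have "\<dots> = b\<^sup>\<oplus> \<cdot> (a\<^sup>\<oplus> \<cdot> a)"
    using assms by (metis assoc plus_closed plus_comm)
  also have "\<dots> = b"
    using assms by (metis nat_le_plus plus_left)
  finally show ?thesis .
qed

lemma nat_le_proj_iff: "e \<in> proj S \<Longrightarrow> f \<in> proj S \<Longrightarrow> nat_le S e f \<longleftrightarrow> e = e \<cdot> f"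
  by (metis nat_leI nat_le_plus proj_closed proj_plus)

lemma sl_le_proj_sl: "e \<in> proj S \<Longrightarrow> f \<in> proj S \<Longrightarrow> sl_le (proj_sl S) e f \<longleftrightarrow> nat_le S e f"
  by (simp add: sl_le_def proj_sl_def nat_le_proj_iff)

lemma proj_nonempty: "\<exists>e. e \<in> proj S"
  using nonempty unfolding proj_def by blast

lemma carrier_proj_sl [simp]: "carrier (proj_sl S) = proj S"
  unfolding proj_sl_def by (rule partial_object.simps(1))

lemma mult_proj_sl [simp]: "e \<cdot>\<^bsub>proj_sl S\<^esub> f = e \<cdot> f"
  unfolding proj_sl_def by (simp only: sgroup.simps)

lemma semilattice_proj_sl: "semilattice_sg (proj_sl S)"
proof (rule semilattice_sg.intro)
  show "carrier (proj_sl S) \<noteq> {}"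
    using proj_nonempty by auto
qed (auto simp: assoc intro: proj_comm)

section \<open>Order ideals, permissible sets and their partial maps\<close>

lemma order_idealD: "order_ideal S A \<Longrightarrow> b \<in> A \<Longrightarrow> nat_le S a b \<Longrightarrow> a \<in> carrier S \<Longrightarrow> a \<in> A"
  by (auto simp: order_ideal_def)

lemma order_ideal_subset: "order_ideal S A \<Longrightarrow> a \<in> A \<Longrightarrow> a \<in> carrier S"
  by (auto simp: order_ideal_def)

lemma order_ideal_proj_mult:
  assumes "order_ideal S A" "a \<in> A" "e \<in> proj S"
  shows "e \<cdot> a \<in> A" "a \<cdot> e \<in> A"
  using assms order_ideal_subset[OF assms(1,2)]
  by (auto intro!: order_idealD[OF assms(1,2)] nat_leI nat_le_mult_proj mult_closed)

text \<open>Projections \<open>e\<close> below \<open>a\<^sup>\<oplus>\<close> correspond to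
  elements \<open>b\<close> below \<open>a\<close> through \<open>b = e \<cdot> a\<close> and
  \<open>e = b\<^sup>\<oplus>\<close>. Indexing by \<open>b\<close> makes the two coordinates
  symmetric.\<close>

lemma munn_eq:
  assumes "a \<in> carrier S"
  shows "munn S a = (\<lambda>b. (b\<^sup>\<oplus>, b\<^sup>\<star>)) ` {b \<in> carrier S. nat_le S b a}"
proof (intro equalityI subsetI)
  fix p assume "p \<in> munn S a"
  then obtain e where e: "e \<in> proj S" "nat_le S e (a\<^sup>\<oplus>)" "p = (e, (e \<cdot> a)\<^sup>\<star>)"
    by (auto simp: munn_def)
  then have "(e \<cdot> a)\<^sup>\<oplus> = e"
    using assms by (metis nat_le_proj_iff plus_in_proj plus_proj_mult)
  then show "p \<in> (\<lambda>b. (b\<^sup>\<oplus>, b\<^sup>\<star>)) ` {b \<in> carrier S. nat_le S b a}"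
    using e assms by (auto intro!: image_eqI[where x = "e \<cdot> a"] nat_leI mult_closed)
next
  fix p assume "p \<in> (\<lambda>b. (b\<^sup>\<oplus>, b\<^sup>\<star>)) ` {b \<in> carrier S. nat_le S b a}"
  then obtain b where b: "b \<in> carrier S" "nat_le S b a" "p = (b\<^sup>\<oplus>, b\<^sup>\<star>)"
    by auto
  have ba: "b\<^sup>\<oplus> \<cdot> a = b"
    using b assms by (metis nat_le_plus)
  then have "nat_le S (b\<^sup>\<oplus>) (a\<^sup>\<oplus>)"
    using b assms by (metis nat_leI plus_in_proj plus_proj_mult)
  then show "p \<in> munn S a"
    using b ba by (auto simp: munn_def)
qed

lemma munn_ext_eq:
  assumes "order_ideal S A"
  shows "munn_ext S A = (\<lambda>b. (b\<^sup>\<oplus>, b\<^sup>\<star>)) ` A"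
proof (intro equalityI subsetI)
  fix p assume "p \<in> munn_ext S A"
  then show "p \<in> (\<lambda>b. (b\<^sup>\<oplus>, b\<^sup>\<star>)) ` A"
    using assms by (auto simp: munn_ext_def munn_eq order_ideal_subset dest: order_idealD)
next
  fix p assume "p \<in> (\<lambda>b. (b\<^sup>\<oplus>, b\<^sup>\<star>)) ` A"
  then show "p \<in> munn_ext S A"
    using munn_eq nat_le_refl order_ideal_subset[OF assms] unfolding munn_ext_def by blast
qed

text \<open>Appending \<open>b\<^sup>\<star>\<close> to \<open>a\<^sup>\<oplus> \<cdot> b\<close>
  and applying both compatibility conditions gives
  \<open>b\<^sup>\<oplus> \<cdot> (b \<cdot> a\<^sup>\<star>)\<close>, where
  \<open>b\<^sup>\<oplus>\<close> is absorbed. So one element has a left form suited to computing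
  its plus and a right form suited to computing its star.\<close>

lemma permissible_mult_eq:
  assumes "permissible S A" "a \<in> A" "b \<in> A"
  shows "a\<^sup>\<oplus> \<cdot> b = a \<cdot> b\<^sup>\<star>"
proof -
  have c: "a \<in> carrier S" "b \<in> carrier S"
    using assms by (auto simp: permissible_def order_ideal_def)
  have ab: "a\<^sup>\<oplus> \<cdot> b = b\<^sup>\<oplus> \<cdot> a" and ba: "a \<cdot> b\<^sup>\<star> = b \<cdot> a\<^sup>\<star>"
    using assms by (auto simp: permissible_def)
  have "a\<^sup>\<oplus> \<cdot> b = (a\<^sup>\<oplus> \<cdot> b) \<cdot> b\<^sup>\<star>"
    using c by (simp add: assoc plus_closed star_closed star_right)
  also have "\<dots> = b\<^sup>\<oplus> \<cdot> (b \<cdot> a\<^sup>\<star>)"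
    using c by (simp add: ab assoc plus_closed star_closed ba)
  also have "\<dots> = a \<cdot> b\<^sup>\<star>"
    using c by (metis assoc plus_closed star_closed plus_left ba)
  finally show ?thesis .
qed

text \<open>If \<open>a\<^sup>\<oplus> = b\<^sup>\<oplus>\<close> then \<open>a = b\<^sup>\<oplus>
  \<cdot> a = a\<^sup>\<oplus> \<cdot> b = b\<close>.\<close>

lemma permissible_inj_plus: "permissible S A \<Longrightarrow> inj_on (rplus S) A"
  by (rule inj_onI) (metis order_ideal_subset permissible_def plus_left)

lemma permissible_inj_star: "permissible S A \<Longrightarrow> inj_on (rstar S) A"
  by (rule inj_onI) (metis order_ideal_subset permissible_def star_right)

lemma munn_ext_ideal_iso:
  assumes A: "permissible S A"
  shows "ideal_iso (proj_sl S) (rplus S ` A) (rstar S ` A) (munn_ext S A)"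
proof -
  have o: "order_ideal S A"
    using A by (simp add: permissible_def)
  have "single_valued (munn_ext S A)" "single_valued ((munn_ext S A)\<inverse>)"
    using permissible_inj_plus[OF A] permissible_inj_star[OF A]
    by (auto simp: munn_ext_eq[OF o] single_valued_def inj_on_def)
  \<comment> \<open>The product of the pairs given by \<open>a\<close> and \<open>b\<close> is the
    pair given by \<open>a\<^sup>\<oplus> \<cdot> b\<close>; its star is read off from the equal
    element \<open>a \<cdot> b\<^sup>\<star>\<close>.\<close>
  moreover have "(a\<^sup>\<oplus> \<cdot> b\<^sup>\<oplus>, a\<^sup>\<star> \<cdot> b\<^sup>\<star>) \<in> munn_ext S A" if ab: "a \<in> A" "b \<in> A" for a b
  proof -
    have c: "a \<in> carrier S" "b \<in> carrier S"
      using ab o by (auto simp: order_ideal_def)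
    have "(a\<^sup>\<oplus> \<cdot> b)\<^sup>\<oplus> = a\<^sup>\<oplus> \<cdot> b\<^sup>\<oplus>" "(a\<^sup>\<oplus> \<cdot> b)\<^sup>\<star> = a\<^sup>\<star> \<cdot> b\<^sup>\<star>"
      using c by (rule plus_mult) (use c permissible_mult_eq[OF A ab] star_mult in simp)
    moreover have "a\<^sup>\<oplus> \<cdot> b \<in> A"
      using c ab o by (simp add: order_ideal_proj_mult)
    ultimately show ?thesis
      by (auto simp: munn_ext_eq[OF o] intro!: image_eqI[where x = "a\<^sup>\<oplus> \<cdot> b"])
  qed
  moreover have "Domain (munn_ext S A) = rplus S ` A" "Range (munn_ext S A) = rstar S ` A"
    by (force simp: munn_ext_eq[OF o])+
  ultimately show ?thesis
    by (auto simp: ideal_iso_def munn_ext_eq[OF o])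
qed

text \<open>A projection \<open>e\<close> below \<open>b\<^sup>\<oplus>\<close> is the plus of
  \<open>e \<cdot> b\<close>, which an order ideal containing \<open>b\<close> also contains. For
  stars the witness is \<open>b \<cdot> e\<close>.\<close>

lemma sl_ideal_plus_image:
  assumes o: "order_ideal S A"
  shows "sl_ideal (proj_sl S) (rplus S ` A)"
proof -
  have "e \<in> rplus S ` A" if "b \<in> A" "e \<in> proj S" "nat_le S e (b\<^sup>\<oplus>)" for b e
  proof (rule image_eqI)
    show "e = (e \<cdot> b)\<^sup>\<oplus>"
      using that o by (metis nat_le_proj_iff order_ideal_subset plus_in_proj plus_proj_mult)
  qed (use that o in \<open>simp add: order_ideal_proj_mult\<close>)
  moreover have "rplus S ` A \<subseteq> proj S" "rplus S ` A \<noteq> {}"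
    using o by (auto simp: order_ideal_def)
  ultimately show ?thesis
    unfolding sl_ideal_def carrier_proj_sl using sl_le_proj_sl by blast
qed

lemma sl_ideal_star_image:
  assumes o: "order_ideal S A"
  shows "sl_ideal (proj_sl S) (rstar S ` A)"
proof -
  have "e \<in> rstar S ` A" if "b \<in> A" "e \<in> proj S" "nat_le S e (b\<^sup>\<star>)" for b e
  proof (rule image_eqI)
    show "e = (b \<cdot> e)\<^sup>\<star>"
      using that o
      by (metis nat_le_proj_iff order_ideal_subset star_in_proj star_mult_proj proj_comm)
  qed (use that o in \<open>simp add: order_ideal_proj_mult\<close>)
  moreover have "rstar S ` A \<subseteq> proj S" "rstar S ` A \<noteq> {}"
    using o by (auto simp: order_ideal_def)
  ultimately show ?thesis
    unfolding sl_ideal_def carrier_proj_sl using sl_le_proj_sl by blast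
qed

lemma munn_ext_in_TI:
  assumes "permissible S A"
  shows "munn_ext S A \<in> TI (proj_sl S)"
  using assms munn_ext_ideal_iso[OF assms]
  by (auto simp: TI_def permissible_def dest: sl_ideal_plus_image sl_ideal_star_image)

lemma permissible_downset:
  assumes m: "m \<in> carrier S"
  shows "permissible S {b \<in> carrier S. nat_le S b m}"
proof -
  have "a\<^sup>\<oplus> \<cdot> b = b\<^sup>\<oplus> \<cdot> a \<and> a \<cdot> b\<^sup>\<star> = b \<cdot> a\<^sup>\<star>"
    if ab: "a \<in> carrier S" "b \<in> carrier S" "nat_le S a m" "nat_le S b m" for a b
  proof
    \<comment> \<open>Elements below \<open>m\<close> are
      \<open>a = a\<^sup>\<oplus> \<cdot> m = m \<cdot> a\<^sup>\<star>\<close>, so compatibility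
      reduces to projections commuting.\<close>
    have "a\<^sup>\<oplus> \<cdot> (b\<^sup>\<oplus> \<cdot> m) = b\<^sup>\<oplus> \<cdot> (a\<^sup>\<oplus> \<cdot> m)"
      using ab m by (metis assoc plus_closed plus_comm)
    then show "a\<^sup>\<oplus> \<cdot> b = b\<^sup>\<oplus> \<cdot> a"
      using ab m nat_le_plus by metis
    have "(m \<cdot> a\<^sup>\<star>) \<cdot> b\<^sup>\<star> = (m \<cdot> b\<^sup>\<star>) \<cdot> a\<^sup>\<star>"
      using ab m by (simp add: assoc star_closed star_comm)
    then show "a \<cdot> b\<^sup>\<star> = b \<cdot> a\<^sup>\<star>"
      using ab m nat_le_star by metis
  qed
  moreover have "order_ideal S {b \<in> carrier S. nat_le S b m}"
    using m nat_le_refl nat_le_trans unfolding order_ideal_def by blast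
  ultimately show ?thesis
    by (auto simp: permissible_def)
qed

text \<open>Makes the Munn map of one element a special case of the extension to permissible sets,
  so that \<open>munn_ext_ideal_iso\<close> applies to it.\<close>

lemma munn_downset:
  assumes "m \<in> carrier S"
  shows "munn_ext S {b \<in> carrier S. nat_le S b m} = munn S m"
  using munn_ext_eq[of "{b \<in> carrier S. nat_le S b m}"] munn_eq[OF assms]
    permissible_downset[OF assms] by (simp add: permissible_def)

lemma plus_image_downset:
  assumes m: "m \<in> carrier S"
  shows "rplus S ` {b \<in> carrier S. nat_le S b m} = principal_ideal (proj_sl S) (m\<^sup>\<oplus>)"
proof (intro equalityI subsetI)
  fix e assume "e \<in> rplus S ` {b \<in> carrier S. nat_le S b m}"
  then obtain b where b: "b \<in> carrier S" "nat_le S b m" "e = b\<^sup>\<oplus>" by auto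
  then have "e = b\<^sup>\<oplus> \<cdot> m\<^sup>\<oplus>"
    using m by (metis nat_le_plus plus_mult)
  then show "e \<in> principal_ideal (proj_sl S) (m\<^sup>\<oplus>)"
    using b m by (simp add: principal_ideal_def sl_le_def)
next
  fix e assume "e \<in> principal_ideal (proj_sl S) (m\<^sup>\<oplus>)"
  then have e: "e \<in> proj S" "e = e \<cdot> m\<^sup>\<oplus>"
    by (auto simp: principal_ideal_def sl_le_def)
  then show "e \<in> rplus S ` {b \<in> carrier S. nat_le S b m}"
    using m by (auto intro!: image_eqI[where x = "e \<cdot> m"] nat_leI mult_closed
        simp: plus_proj_mult)
qed

lemma star_image_downset:
  assumes m: "m \<in> carrier S"
  shows "rstar S ` {b \<in> carrier S. nat_le S b m} = principal_ideal (proj_sl S) (m\<^sup>\<star>)"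
proof (intro equalityI subsetI)
  fix e assume "e \<in> rstar S ` {b \<in> carrier S. nat_le S b m}"
  then obtain b where b: "b \<in> carrier S" "nat_le S b m" "e = b\<^sup>\<star>" by auto
  then have "e = b\<^sup>\<star> \<cdot> m\<^sup>\<star>"
    using m by (metis nat_le_star star_mult star_comm)
  then show "e \<in> principal_ideal (proj_sl S) (m\<^sup>\<star>)"
    using b m by (simp add: principal_ideal_def sl_le_def)
next
  fix e assume "e \<in> principal_ideal (proj_sl S) (m\<^sup>\<star>)"
  then have e: "e \<in> proj S" "e = m\<^sup>\<star> \<cdot> e"
    using m proj_comm[of e "m\<^sup>\<star>"] by (simp_all add: principal_ideal_def sl_le_def)
  then show "e \<in> rstar S ` {b \<in> carrier S. nat_le S b m}"
    using m by (auto intro!: image_eqI[where x = "m \<cdot> e"] nat_le_mult_proj mult_closed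
        simp: star_mult_proj)
qed

lemma munn_in_TP:
  assumes "a \<in> carrier S"
  shows "munn S a \<in> TP (proj_sl S)"
proof -
  have "ideal_iso (proj_sl S) (principal_ideal (proj_sl S) (a\<^sup>\<oplus>))
          (principal_ideal (proj_sl S) (a\<^sup>\<star>)) (munn S a)"
    using munn_ext_ideal_iso[OF permissible_downset[OF assms]] assms
    by (simp add: munn_downset plus_image_downset star_image_downset)
  moreover have "a\<^sup>\<oplus> \<in> carrier (proj_sl S)" "a\<^sup>\<star> \<in> carrier (proj_sl S)"
    using assms by simp_all
  ultimately show ?thesis
    unfolding TP_def by blast
qed

section \<open>The congruence \<open>sigma\<close>\<close>

lemma sigmaI:
  "a \<in> carrier S \<Longrightarrow> b \<in> carrier S \<Longrightarrow> e \<in> proj S \<Longrightarrow> e \<cdot> a = e \<cdot> b \<Longrightarrow> (a, b) \<in> sigma S"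
  by (auto simp: sigma_def)

lemma sigma_equiv: "equiv (carrier S) (sigma S)"
proof (rule equivI)
  show "sigma S \<subseteq> carrier S \<times> carrier S"
    by (auto simp: sigma_def)
  show "refl_on (carrier S) (sigma S)"
    using proj_nonempty by (auto simp: sigma_def refl_on_def)
  show "sym (sigma S)"
  proof (rule symI)
    fix a b assume "(a, b) \<in> sigma S"
    then obtain e where "a \<in> carrier S" "b \<in> carrier S" "e \<in> proj S" "e \<cdot> a = e \<cdot> b"
      by (auto simp: sigma_def)
    then show "(b, a) \<in> sigma S"
      by (auto intro!: sigmaI[where e = e])
  qed
  show "trans (sigma S)"
  proof (rule transI)
    fix a b c assume "(a, b) \<in> sigma S" "(b, c) \<in> sigma S"
    then obtain e f where *: "a \<in> carrier S" "b \<in> carrier S" "c \<in> carrier S" "e \<in> proj S"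
        "f \<in> proj S" "e \<cdot> a = e \<cdot> b" "f \<cdot> b = f \<cdot> c"
      by (auto simp: sigma_def)
    \<comment> \<open>The product of the two witnesses is a witness for \<open>a\<close> and
      \<open>c\<close>: commuting projections bring whichever is needed next to the element.\<close>
    have "(f \<cdot> e) \<cdot> a = f \<cdot> (e \<cdot> b)"
      using * by (simp add: assoc)
    also have "\<dots> = e \<cdot> (f \<cdot> b)"
      using * by (metis assoc proj_closed proj_comm)
    also have "\<dots> = (f \<cdot> e) \<cdot> c"
      using * by (metis assoc proj_closed proj_comm)
    finally show "(a, c) \<in> sigma S"
      using * by (auto intro!: sigmaI[where e = "f \<cdot> e"])
  qed
qed

lemma sigma_refl: "a \<in> carrier S \<Longrightarrow> (a, a) \<in> sigma S"
  using sigma_equiv by (blast elim: equivE dest: refl_onD)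

lemma sigma_sym: "(a, b) \<in> sigma S \<Longrightarrow> (b, a) \<in> sigma S"
  using sigma_equiv by (blast elim: equivE dest: symD)

lemma sigma_trans: "(a, b) \<in> sigma S \<Longrightarrow> (b, c) \<in> sigma S \<Longrightarrow> (a, c) \<in> sigma S"
  using sigma_equiv by (blast elim: equivE dest: transD)

lemmas sigma_eq_iff = eq_equiv_class_iff[OF sigma_equiv]

lemma sigma_cong:
  assumes "(a, b) \<in> sigma S" "(c, d) \<in> sigma S"
  shows "(a \<cdot> c, b \<cdot> d) \<in> sigma S"
proof -
  obtain e f where *: "a \<in> carrier S" "b \<in> carrier S" "c \<in> carrier S" "d \<in> carrier S"
      "e \<in> proj S" "f \<in> proj S" "e \<cdot> a = e \<cdot> b" "f \<cdot> c = f \<cdot> d"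
    using assms by (auto simp: sigma_def)
  have "(a \<cdot> c, b \<cdot> c) \<in> sigma S"
    using * by (intro sigmaI[where e = e]) (auto simp: mult_closed assoc[symmetric])
  \<comment> \<open>The witness \<open>f\<close> for \<open>c\<close> and \<open>d\<close> would
    stand to the right of \<open>b\<close>; the ample identity moves it to the left as
    \<open>(b \<cdot> f)\<^sup>\<oplus>\<close>.\<close>
  moreover have "(b \<cdot> c, b \<cdot> d) \<in> sigma S"
  proof (rule sigmaI[where e = "(b \<cdot> f)\<^sup>\<oplus>"])
    have "(b \<cdot> f)\<^sup>\<oplus> \<cdot> (b \<cdot> x) = b \<cdot> (f \<cdot> x)" if "x \<in> carrier S" for x
      using * that by (metis assoc mult_closed mult_proj plus_closed proj_closed)
    then show "(b \<cdot> f)\<^sup>\<oplus> \<cdot> (b \<cdot> c) = (b \<cdot> f)\<^sup>\<oplus> \<cdot> (b \<cdot> d)"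
      using * by simp
  qed (use * in \<open>simp_all add: mult_closed\<close>)
  ultimately show ?thesis
    by (rule sigma_trans)
qed

lemma sigma_proj: "e \<in> proj S \<Longrightarrow> f \<in> proj S \<Longrightarrow> (e, f) \<in> sigma S"
  by (rule sigmaI[where e = "e \<cdot> f"]) (simp_all, metis assoc proj_closed proj_comm proj_idem)

lemma sigma_proj_mult: "e \<in> proj S \<Longrightarrow> a \<in> carrier S \<Longrightarrow> (e \<cdot> a, a) \<in> sigma S"
  by (rule sigmaI[where e = e]) (simp_all add: mult_closed flip: assoc)

lemma sigma_mult_proj: "e \<in> proj S \<Longrightarrow> a \<in> carrier S \<Longrightarrow> (a \<cdot> e, a) \<in> sigma S"
  by (metis mult_closed mult_proj plus_in_proj proj_closed sigma_proj_mult)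

lemma sigma_class_proj: "e \<in> proj S \<Longrightarrow> sigma S `` proj S = sigma S `` {e}"
  using sigma_proj sigma_trans by blast

lemma order_ideal_sigma_class:
  assumes "a \<in> carrier S"
  shows "order_ideal S (sigma S `` {a})"
  unfolding order_ideal_def
proof (intro conjI ballI impI)
  show "sigma S `` {a} \<subseteq> carrier S"
    by (auto simp: sigma_def)
  show "sigma S `` {a} \<noteq> {}"
    using assms equiv_class_self[OF sigma_equiv] by auto
  fix b c assume bc: "b \<in> sigma S `` {a}" "c \<in> carrier S" "nat_le S c b"
  then obtain e where "e \<in> proj S" "c = e \<cdot> b" "b \<in> carrier S"
    by (auto simp: nat_le_def sigma_def)
  then have "(c, b) \<in> sigma S"
    by (simp add: sigma_proj_mult)
  then show "c \<in> sigma S `` {a}"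
    using bc by (auto intro: sigma_sym sigma_trans)
qed

section \<open>The quotient monoid\<close>

lemma sigma_class_carrier [simp]: "a \<in> carrier S \<Longrightarrow> sigma S `` {a} \<in> carrier (sigma_quot S)"
  by (simp add: sigma_quot_def quotientI)

lemma sigma_quotE:
  assumes "t \<in> carrier (sigma_quot S)"
  obtains a where "a \<in> carrier S" "t = sigma S `` {a}"
  using assms by (auto simp: sigma_quot_def elim: quotientE)

text \<open>By \<open>sigma_cong\<close>, all classes in the union that defines the product
  coincide, so representatives suffice.\<close>

lemma sigma_quot_mult:
  assumes "a \<in> carrier S" "b \<in> carrier S"
  shows "sigma S `` {a} \<otimes>\<^bsub>sigma_quot S\<^esub> sigma S `` {b} = sigma S `` {a \<cdot> b}"
proof -
  have "congruent2 (sigma S) (sigma S) (\<lambda>a b. sigma S `` {a \<cdot> b})"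
    by (auto simp: congruent2_def intro!: equiv_class_eq[OF sigma_equiv] sigma_cong)
  then show ?thesis
    using UN_equiv_class2[OF sigma_equiv sigma_equiv] assms by (simp add: sigma_quot_def)
qed

lemma sigma_quot_one: "e \<in> proj S \<Longrightarrow> \<one>\<^bsub>sigma_quot S\<^esub> = sigma S `` {e}"
  by (simp add: sigma_quot_def sigma_class_proj)

lemma monoid_sigma_quot: "Group.monoid (sigma_quot S)"
proof -
  obtain e where e: "e \<in> proj S"
    using proj_nonempty by blast
  note one = sigma_quot_one[OF e]
  show ?thesis
  proof
    show "\<one>\<^bsub>sigma_quot S\<^esub> \<in> carrier (sigma_quot S)"
      using e by (simp add: one)
    fix x assume "x \<in> carrier (sigma_quot S)"
    then obtain a where a: "a \<in> carrier S" "x = sigma S `` {a}"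
      by (rule sigma_quotE)
    show "\<one>\<^bsub>sigma_quot S\<^esub> \<otimes>\<^bsub>sigma_quot S\<^esub> x = x" "x \<otimes>\<^bsub>sigma_quot S\<^esub> \<one>\<^bsub>sigma_quot S\<^esub> = x"
      using a e sigma_proj_mult[OF e a(1)] sigma_mult_proj[OF e a(1)]
      by (simp_all add: one sigma_quot_mult equiv_class_eq[OF sigma_equiv])
  qed (auto elim!: sigma_quotE simp: sigma_quot_mult mult_closed assoc)
qed

lemma kappa_apply: "a \<in> carrier S \<Longrightarrow> kappa S (sigma S `` {a}) = sigma S `` {a}"
  by (simp add: kappa_def)

lemma inj_on_kappa: "inj_on (kappa S) (carrier (sigma_quot S))"
  by (simp add: kappa_def inj_on_def)

lemma munn_ext_sigma_class:
  assumes "a \<in> carrier S"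
  shows "munn_ext S (sigma S `` {a}) = {(b\<^sup>\<oplus>, b\<^sup>\<star>) | b. (a, b) \<in> sigma S}"
  by (auto simp: munn_ext_eq[OF order_ideal_sigma_class[OF assms]])

end

section \<open>Consequences of properness\<close>

context proper_restriction_semigroup
begin

lemma sigma_plus_inj: "(a, b) \<in> sigma S \<Longrightarrow> a\<^sup>\<oplus> = b\<^sup>\<oplus> \<Longrightarrow> a = b"
proof -
  assume ab: "(a, b) \<in> sigma S" "a\<^sup>\<oplus> = b\<^sup>\<oplus>"
  then have "(a, b) \<in> R_rel S \<inter> sigma S"
    by (auto simp: R_rel_def sigma_def)
  then show "a = b"
    by (simp add: R_proper Id_on_iff)
qed

lemma sigma_star_inj: "(a, b) \<in> sigma S \<Longrightarrow> a\<^sup>\<star> = b\<^sup>\<star> \<Longrightarrow> a = b"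
proof -
  assume ab: "(a, b) \<in> sigma S" "a\<^sup>\<star> = b\<^sup>\<star>"
  then have "(a, b) \<in> L_rel S \<inter> sigma S"
    by (auto simp: L_rel_def sigma_def)
  then show "a = b"
    by (simp add: L_proper Id_on_iff)
qed

text \<open>In each equation both sides lie in the class of \<open>a\<close> and \<open>b\<close>,
  and they have equal plus (first equation) or equal star (second). Properness then identifies
  them.\<close>

lemma sigma_compatible:
  assumes ab: "(a, b) \<in> sigma S"
  shows "a\<^sup>\<oplus> \<cdot> b = b\<^sup>\<oplus> \<cdot> a" "a \<cdot> b\<^sup>\<star> = b \<cdot> a\<^sup>\<star>"
proof -
  have c: "a \<in> carrier S" "b \<in> carrier S"
    using ab by (auto simp: sigma_def)
  have "(a\<^sup>\<oplus> \<cdot> b, b\<^sup>\<oplus> \<cdot> a) \<in> sigma S" "(a \<cdot> b\<^sup>\<star>, b \<cdot> a\<^sup>\<star>) \<in> sigma S"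
    using c
      sigma_trans[OF sigma_proj_mult sigma_trans[OF sigma_sym[OF ab] sigma_sym[OF sigma_proj_mult]]]
      sigma_trans[OF sigma_mult_proj sigma_trans[OF ab sigma_sym[OF sigma_mult_proj]]]
    by simp_all
  moreover have "(a\<^sup>\<oplus> \<cdot> b)\<^sup>\<oplus> = (b\<^sup>\<oplus> \<cdot> a)\<^sup>\<oplus>" "(a \<cdot> b\<^sup>\<star>)\<^sup>\<star> = (b \<cdot> a\<^sup>\<star>)\<^sup>\<star>"
    using c by (simp_all add: plus_mult star_mult plus_comm star_comm)
  ultimately show "a\<^sup>\<oplus> \<cdot> b = b\<^sup>\<oplus> \<cdot> a" "a \<cdot> b\<^sup>\<star> = b \<cdot> a\<^sup>\<star>"
    by (blast intro: sigma_plus_inj sigma_star_inj)+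
qed

lemma permissible_sigma_class:
  assumes "a \<in> carrier S"
  shows "permissible S (sigma S `` {a})"
  using order_ideal_sigma_class[OF assms]
  by (auto simp: permissible_def intro!: sigma_compatible intro: sigma_sym sigma_trans)

lemma kappa_in_perm_monoid: "kappa S \<in> carrier (sigma_quot S) \<rightarrow> carrier (perm_monoid S)"
  by (auto elim!: sigma_quotE simp: kappa_apply permissible_sigma_class perm_monoid_def)

section \<open>The sub-action on the projections\<close>

lemma sigma_class_proj_eq: "sigma S `` proj S = proj S"
proof
  show "sigma S `` proj S \<subseteq> proj S"
  proof
    fix b assume "b \<in> sigma S `` proj S"
    then obtain e where e: "e \<in> proj S" "(e, b) \<in> sigma S" "b \<in> carrier S"
      by (auto simp: sigma_def)
    \<comment> \<open>All projections lie in one class, which contains \<open>b\<close>; since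
      \<open>b\<close> and \<open>b\<^sup>\<oplus>\<close> also have the same plus, they are
      equal.\<close>
    then have "(b, b\<^sup>\<oplus>) \<in> sigma S"
      by (blast intro: sigma_proj sigma_sym sigma_trans plus_in_proj)
    then have "b = b\<^sup>\<oplus>"
      using e by (auto intro: sigma_plus_inj)
    then show "b \<in> proj S"
      using e plus_in_proj by metis
  qed
qed (use sigma_proj in blast)

lemma munn_ext_one: "munn_ext S (sigma S `` proj S) = Id_on (proj S)"
proof -
  obtain e where e: "e \<in> proj S"
    using proj_nonempty by blast
  have "order_ideal S (proj S)"
    using order_ideal_sigma_class[of e] e sigma_class_proj[OF e] sigma_class_proj_eq by simp
  then show ?thesis
    by (auto simp: sigma_class_proj_eq munn_ext_eq Id_on_def)
qed

text \<open>Pairs given by \<open>x\<close> and \<open>y\<close> compose exactly when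
  \<open>x\<^sup>\<star> = y\<^sup>\<oplus>\<close>. Then \<open>(x \<cdot> y)\<^sup>\<oplus> = (x
  \<cdot> x\<^sup>\<star>)\<^sup>\<oplus> = x\<^sup>\<oplus>\<close> and dually
  \<open>(x \<cdot> y)\<^sup>\<star> = y\<^sup>\<star>\<close>, so \<open>x \<cdot> y\<close> gives
  the composite pair.\<close>

lemma munn_ext_mult:
  assumes a: "a \<in> carrier S" and b: "b \<in> carrier S"
  shows "munn_ext S (sigma S `` {a}) O munn_ext S (sigma S `` {b})
           \<subseteq> munn_ext S (sigma S `` {a \<cdot> b})"
proof -
  have "(x\<^sup>\<oplus>, y\<^sup>\<star>) \<in> munn_ext S (sigma S `` {a \<cdot> b})"
    if xy: "(a, x) \<in> sigma S" "(b, y) \<in> sigma S" "x\<^sup>\<star> = y\<^sup>\<oplus>" for x y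
  proof -
    have c: "x \<in> carrier S" "y \<in> carrier S"
      using xy by (auto simp: sigma_def)
    have "(x \<cdot> y)\<^sup>\<oplus> = x\<^sup>\<oplus>" "(x \<cdot> y)\<^sup>\<star> = y\<^sup>\<star>"
      using c xy(3) plus_left star_right plus_mult_plus star_star_mult by metis+
    then show ?thesis
      using sigma_cong[OF xy(1,2)] a b
      by (simp add: munn_ext_sigma_class mult_closed) metis
  qed
  then show ?thesis
    using a b by (force simp: munn_ext_sigma_class[of a] munn_ext_sigma_class[of b])
qed

abbreviation action :: "'a set \<Rightarrow> ('a \<times> 'a) set" where
  "action \<equiv> munn_ext S \<circ> kappa S"

lemma sub_action_munn: "sub_action (sigma_quot S) (proj_sl S) action"
proof -
  interpret T: Group.monoid "sigma_quot S" by (rule monoid_sigma_quot)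
  interpret Y: semilattice_sg "proj_sl S" by (rule semilattice_proj_sl)
  show ?thesis
  proof
    fix t assume "t \<in> carrier (sigma_quot S)"
    then show "action t \<in> TI (proj_sl S)"
      by (auto elim!: sigma_quotE simp: kappa_apply permissible_sigma_class munn_ext_in_TI)
  next
    obtain e where e: "e \<in> proj S"
      using proj_nonempty by blast
    have "action \<one>\<^bsub>sigma_quot S\<^esub> = munn_ext S (sigma S `` proj S)"
      using e by (simp add: sigma_quot_one sigma_class_proj kappa_apply)
    then show "action \<one>\<^bsub>sigma_quot S\<^esub> = Id_on (carrier (proj_sl S))"
      by (simp add: munn_ext_one proj_sl_def)
  next
    fix t u assume "t \<in> carrier (sigma_quot S)" "u \<in> carrier (sigma_quot S)"
    then obtain a b where "a \<in> carrier S" "t = sigma S `` {a}" "b \<in> carrier S" "u = sigma S `` {b}"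
      by (metis sigma_quotE)
    then show "action t O action u \<subseteq> action (t \<otimes>\<^bsub>sigma_quot S\<^esub> u)"
      using munn_ext_mult[of a b] by (simp add: kappa_apply sigma_quot_mult mult_closed)
  qed
qed

section \<open>The isomorphism onto \<open>W\<close>\<close>

lemma app_munn_ext:
  assumes "a \<in> carrier S" "(a, b) \<in> sigma S"
  shows "app (munn_ext S (sigma S `` {a})) (b\<^sup>\<oplus>) = b\<^sup>\<star>"
    and "app ((munn_ext S (sigma S `` {a}))\<inverse>) (b\<^sup>\<star>) = b\<^sup>\<oplus>"
proof -
  \<comment> \<open>Either projection determines an element within its class; this is the uniqueness
    behind \<open>THE\<close> in \<open>app\<close>, for the map and for its converse.\<close>
  have *: "b = x" if "(a, x) \<in> sigma S" "b\<^sup>\<oplus> = x\<^sup>\<oplus> \<or> b\<^sup>\<star> = x\<^sup>\<star>" for x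
    using that assms by (blast intro: sigma_plus_inj sigma_star_inj sigma_sym sigma_trans)
  show "app (munn_ext S (sigma S `` {a})) (b\<^sup>\<oplus>) = b\<^sup>\<star>"
    unfolding app_def munn_ext_sigma_class[OF assms(1)]
    by (rule the_equality) (use assms in \<open>auto dest: *\<close>)
  show "app ((munn_ext S (sigma S `` {a}))\<inverse>) (b\<^sup>\<star>) = b\<^sup>\<oplus>"
    unfolding app_def munn_ext_sigma_class[OF assms(1)]
    by (rule the_equality) (use assms in \<open>auto dest: *\<close>)
qed

lemma iso_W:
  "(\<lambda>a. (sigma S `` {a}, a\<^sup>\<star>)) \<in> restr_iso S (W (sigma_quot S) (proj_sl S) action)"
    (is "?\<phi> \<in> restr_iso S ?W")
  unfolding restr_iso_def mem_Collect_eq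
proof (intro conjI ballI)
  show "bij_betw ?\<phi> (carrier S) (carrier ?W)"
  proof (rule bij_betw_imageI)
    show "inj_on ?\<phi> (carrier S)"
      by (rule inj_onI) (auto simp: sigma_eq_iff intro: sigma_star_inj)
    show "?\<phi> ` carrier S = carrier ?W"
    proof (intro equalityI subsetI)
      fix p assume "p \<in> ?\<phi> ` carrier S"
      then show "p \<in> carrier ?W"
        by (fastforce simp: W_def kappa_apply munn_ext_sigma_class dest: sigma_refl)
    next
      fix p assume "p \<in> carrier ?W"
      then obtain a b where ab: "a \<in> carrier S" "(a, b) \<in> sigma S" "p = (sigma S `` {a}, b\<^sup>\<star>)"
        by (auto simp: W_def kappa_apply munn_ext_sigma_class elim!: sigma_quotE)
      moreover have "b \<in> carrier S"
        using ab by (auto simp: sigma_def)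
      ultimately show "p \<in> ?\<phi> ` carrier S"
        using equiv_class_eq[OF sigma_equiv ab(2)] by auto
    qed
  qed
  fix x assume x: "x \<in> carrier S"
  show "?\<phi> (x\<^sup>\<oplus>) = (?\<phi> x)\<^sup>\<oplus>\<^bsub>?W\<^esub>"
    using x by (simp add: W_def kappa_apply app_munn_ext sigma_refl plus_star
        sigma_quot_one[of "x\<^sup>\<oplus>"])
  show "?\<phi> (x\<^sup>\<star>) = (?\<phi> x)\<^sup>\<star>\<^bsub>?W\<^esub>"
    using x by (simp add: W_def sigma_quot_one[of "x\<^sup>\<star>"])
  fix y assume y: "y \<in> carrier S"
  \<comment> \<open>The product in \<open>W\<close> applies the map of the class of \<open>y\<close>
    to \<open>x\<^sup>\<star> \<cdot> y\<^sup>\<oplus>\<close>. That projection is the plus of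
    \<open>x\<^sup>\<star> \<cdot> y\<close>, a member of the class whose star is
    \<open>(x \<cdot> y)\<^sup>\<star>\<close>.\<close>
  have "(y, x\<^sup>\<star> \<cdot> y) \<in> sigma S"
    using x y by (simp add: sigma_sym sigma_proj_mult)
  then have "app (munn_ext S (sigma S `` {y})) (x\<^sup>\<star> \<cdot> y\<^sup>\<oplus>) = (x \<cdot> y)\<^sup>\<star>"
    using x y app_munn_ext(1)[of y "x\<^sup>\<star> \<cdot> y"] by (simp add: plus_proj_mult star_star_mult)
  then show "?\<phi> (x \<cdot> y) = ?\<phi> x \<cdot>\<^bsub>?W\<^esub> ?\<phi> y"
    using x y
    by (simp add: W_def kappa_apply app_munn_ext sigma_refl sigma_quot_mult)
qed

end

section \<open>Identities and greatest elements of classes\<close>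

lemma (in restriction_semigroup) has_identity_proj_sl:
  assumes "has_identity S"
  shows "has_identity (proj_sl S)"
proof -
  obtain u where u: "u \<in> carrier S" "\<And>x. x \<in> carrier S \<Longrightarrow> u \<cdot> x = x \<and> x \<cdot> u = x"
    using assms by (auto simp: has_identity_def)
  \<comment> \<open>Both equal \<open>u\<^sup>\<oplus> \<cdot> u\<close>, so the identity of
    \<open>S\<close> is a projection.\<close>
  then have "u\<^sup>\<oplus> = u"
    by (metis plus_closed plus_left)
  then have "u \<in> proj S"
    using u plus_in_proj by metis
  then show ?thesis
    using u unfolding has_identity_def by (auto intro!: bexI[where x = u])
qed

lemma (in F_restriction_monoid) munn_ext_eq_munn_max:
  assumes a: "a \<in> carrier S"
  shows "max_elem S (sigma S `` {a}) \<in> carrier S"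
    and "munn_ext S (sigma S `` {a}) = munn S (max_elem S (sigma S `` {a}))"
proof -
  let ?A = "sigma S `` {a}"
  have o: "order_ideal S ?A"
    using a by (rule order_ideal_sigma_class)
  obtain m where m: "is_greatest S ?A m"
    using class_greatest a quotientI by metis
  have mS: "m \<in> carrier S"
    using m o by (auto simp: is_greatest_def order_ideal_subset)
  \<comment> \<open>Antisymmetry of the natural order justifies the definite description in
    \<open>max_elem\<close>.\<close>
  have eq: "max_elem S ?A = m"
    unfolding max_elem_def
  proof (rule the_equality)
    show "is_greatest S ?A m" by fact
    fix n assume "is_greatest S ?A n"
    then show "n = m"
      using m mS o by (intro nat_le_antisym) (auto simp: is_greatest_def dest: order_ideal_subset)
  qed
  have "?A = {b \<in> carrier S. nat_le S b m}"
    using m o by (auto simp: is_greatest_def dest: order_ideal_subset order_idealD)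
  then show "max_elem S ?A \<in> carrier S" "munn_ext S ?A = munn S (max_elem S ?A)"
    using mS eq munn_downset by auto
qed

theorem theorem9p3:
  fixes S :: "('a, 'm) restr_scheme"
  assumes "proper_restriction_semigroup S"
  shows
    "(let T = sigma_quot S; Y = proj_sl S; \<alpha> = munn_ext S \<circ> kappa S in
        kappa S \<in> carrier T \<rightarrow> carrier (perm_monoid S) \<and> inj_on (kappa S) (carrier T) \<and>
        sub_action T Y \<alpha> \<and>
        (\<exists>\<phi>. \<phi> \<in> restr_iso S (W T Y \<alpha>)) \<and>
        (F_restriction_monoid S \<longrightarrow>
           has_identity Y \<and>
           (\<forall>t\<in>carrier T. \<alpha> t \<in> TP Y) \<and>
           (\<forall>a\<in>carrier S. \<alpha> (sigma S `` {a}) = munn S (max_elem S (sigma S `` {a})))))"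
proof -
  interpret proper_restriction_semigroup S by fact
  have "has_identity (proj_sl S) \<and> (\<forall>t\<in>carrier (sigma_quot S). action t \<in> TP (proj_sl S)) \<and>
      (\<forall>a\<in>carrier S. action (sigma S `` {a}) = munn S (max_elem S (sigma S `` {a})))"
    if "F_restriction_monoid S"
  proof -
    interpret F_restriction_monoid S by fact
    show ?thesis
      \<comment> \<open>Each element of the quotient is the class of some \<open>a\<close>, so its
        map is the Munn map of one element and hence lies in \<open>TP\<close>.\<close>
      using has_identity_proj_sl[OF identity] munn_ext_eq_munn_max munn_in_TP
      by (auto simp: kappa_apply elim!: sigma_quotE)
  qed
  then show ?thesis
    unfolding Let_def
    using kappa_in_perm_monoid inj_on_kappa sub_action_munn iso_W by blast
qed

end
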